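(* Let $(x_j)_{j\in J}$ be a frame for a finite-dimensional real Hilbert space $H$ and let $\lambda,\alpha>0$. Then the following are equivalent: (a) $(x_j)_{j\in J}$ does $\lambda$-saturation recovery on $\alpha B_H$. (b) For all $x\in H$ with $\|x\|<\alpha$, $(x_j)_{j\in J_\lambda^\sharp(x)}$ is a frame of $H$. (c) For all $x\in H$ with $\|x\|\le\alpha$, $(x_j)_{j\in J_\lambda(x)}$ is a frame of $H$.
   Context: A family $(x_j)_{j\in J}$ in a Hilbert space $H$ is a frame of $H$ if there are constants $A,B>0$ (frame bounds) with $A\|x\|^2\le\sum_{j\in J}|\langle x,x_j\rangle|^2\le B\|x\|^2$ for all $x\in H$. Its analysis operator is $\Theta:H\to\ell_2(J)$, $\Theta x=(\langle x,x_j\rangle)_{j\in J}$. For $\lambda>0$, $\phi_\lambda:\mathbb{R}\to[-\lambda,\lambda]$ is given by $\phi_\lambda(t)=t$ if $|t|\le\lambda$ and $\phi_\lambda(t)=\mathrm{sign}(t)\lambda$ if $|t|>\lambda$, and $\Phi_\lambda:\ell_2(J)\to\ell_2(J)$ is $\Phi_\lambda((a_j)_{j\in J})=(\phi_\lambda(a_j))_{j\in J}$. The frame does $\lambda$-saturation recovery on a set $X\subseteq H$ if $\Phi_\lambda\Theta|_X:X\to\ell_2(J)$ is one-to-one. $B_H$ is the closed unit ball of $H$ and $\alpha B_H=\{\alpha x:x\in B_H\}$. For $x\in H$, $J_\lambda(x)=\{j\in J:|\langle x,x_j\rangle|\le\lambda\}$ and $J_\lambda^\sharp(x)=\{j\in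 J:|\langle x,x_j\rangle|<\lambda\}$. The index set $J$ may be infinite. *)

theory Defs
  imports "HOL-Analysis.Analysis"
begin

text \<open>
  Finite-dimensional real Hilbert spaces are taken to be types of class \<open>real_inner\<close> spanned by a
  finite set: completeness is then automatic, and unlike with \<open>euclidean_space\<close> the zero space is
  included.

  A family in \<open>'a\<close> is given by an index set \<open>J\<close> together with \<open>x :: 'j \<Rightarrow> 'a\<close>, of which only the
  values on \<open>J\<close> matter; the family restricted to indices in \<open>K\<close> is then the pair \<open>K\<close>, \<open>x\<close>.
\<close>

text \<open>
  Summability is stated explicitly, because \<open>infsum\<close> is \<open>0\<close> on families that are not summable.
\<close>

definition frame_on :: "'j set \<Rightarrow> ('j \<Rightarrow> 'a::real_inner) \<Rightarrow> bool" where
  "frame_on J x \<longleftrightarrow> (\<exists>A>0. \<exists>B>0. \<forall>v.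
     (\<lambda>j. \<bar>v \<bullet> x j\<bar>\<^sup>2) summable_on J \<and>
     A * (norm v)\<^sup>2 \<le> (\<Sum>\<^sub>\<infinity>j\<in>J. \<bar>v \<bullet> x j\<bar>\<^sup>2) \<and>
     (\<Sum>\<^sub>\<infinity>j\<in>J. \<bar>v \<bullet> x j\<bar>\<^sup>2) \<le> B * (norm v)\<^sup>2)"

text \<open>
  Elements of \<open>\<ell>\<^sub>2(J)\<close> are represented by functions that are \<open>undefined\<close> outside \<open>J\<close>, so that
  equality of functions is equality of families indexed by \<open>J\<close>.
\<close>

definition ell2_on :: "'j set \<Rightarrow> ('j \<Rightarrow> real) set" where
  "ell2_on J = {a \<in> extensional J. (\<lambda>j. \<bar>a j\<bar>\<^sup>2) summable_on J}"

definition analysis_op :: "'j set \<Rightarrow> ('j \<Rightarrow> 'a::real_inner) \<Rightarrow> 'a \<Rightarrow> 'j \<Rightarrow> real" where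
  "analysis_op J x v = (\<lambda>j\<in>J. v \<bullet> x j)"

definition sat :: "real \<Rightarrow> real \<Rightarrow> real" where
  "sat l t = (if \<bar>t\<bar> \<le> l then t else sgn t * l)"

definition sat_op :: "real \<Rightarrow> 'j set \<Rightarrow> ('j \<Rightarrow> real) \<Rightarrow> 'j \<Rightarrow> real" where
  "sat_op l J a = (\<lambda>j\<in>J. sat l (a j))"

definition saturation_recovery ::
    "real \<Rightarrow> 'j set \<Rightarrow> ('j \<Rightarrow> 'a::real_inner) \<Rightarrow> 'a set \<Rightarrow> bool" where
  "saturation_recovery l J x X \<longleftrightarrow> inj_on (sat_op l J \<circ> analysis_op J x) X"

definition unsat_index :: "real \<Rightarrow> 'j set \<Rightarrow> ('j \<Rightarrow> 'a::real_inner) \<Rightarrow> 'a \<Rightarrow> 'j set" where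
  "unsat_index l J x v = {j \<in> J. \<bar>v \<bullet> x j\<bar> \<le> l}"

definition strict_unsat_index :: "real \<Rightarrow> 'j set \<Rightarrow> ('j \<Rightarrow> 'a::real_inner) \<Rightarrow> 'a \<Rightarrow> 'j set" where
  "strict_unsat_index l J x v = {j \<in> J. \<bar>v \<bullet> x j\<bar> < l}"

text \<open>The operators have the codomains that their definitions presuppose.\<close>

lemma analysis_op_in_ell2:
  assumes "frame_on J x"
  shows "analysis_op J x v \<in> ell2_on J"
proof -
  have "(\<lambda>j. \<bar>v \<bullet> x j\<bar>\<^sup>2) summable_on J"
    using assms unfolding frame_on_def by blast
  then have "(\<lambda>j. \<bar>analysis_op J x v j\<bar>\<^sup>2) summable_on J"
    by (rule summable_on_cong[THEN iffD1, rotated]) (simp add: analysis_op_def)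
  then show ?thesis
    by (simp add: ell2_on_def analysis_op_def)
qed

lemma sat_bounds:
  assumes "l > 0"
  shows "\<bar>sat l t\<bar> \<le> l" and "\<bar>sat l t\<bar> \<le> \<bar>t\<bar>"
  using assms by (auto simp: sat_def abs_mult sgn_if)

lemma sat_op_in_ell2:
  assumes "l > 0" and "a \<in> ell2_on J"
  shows "sat_op l J a \<in> ell2_on J"
proof -
  have "(\<lambda>j. \<bar>a j\<bar>\<^sup>2) summable_on J"
    using assms(2) by (simp add: ell2_on_def)
  then have "(\<lambda>j. \<bar>sat_op l J a j\<bar>\<^sup>2) summable_on J"
  proof (rule summable_on_comparison_test)
    show "\<bar>sat_op l J a j\<bar>\<^sup>2 \<le> \<bar>a j\<bar>\<^sup>2" if "j \<in> J" for j
      using that sat_bounds(2)[OF assms(1), of "a j"] by (simp add: sat_op_def abs_le_square_iff)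
  qed simp
  then show ?thesis
    by (simp add: ell2_on_def sat_op_def)
qed

end

theory Submission
  imports Defs
begin

text \<open>
  In finite dimension, a subfamily of a frame is itself a frame as soon as no nonzero vector is
  orthogonal to all of its members, since it then spans the space. The three
  implications follow by perturbing \<open>v\<close>. If \<open>w \<noteq> 0\<close> is orthogonal to the strictly unsaturated
  \<open>x\<^sub>j\<close> at \<open>v\<close>, then stretching \<open>v\<close> slightly to \<open>v'\<close> saturates all other coordinates with a
  margin, so \<open>v'\<close> and \<open>v' + t w\<close> have the same saturated coefficients. Shrinking \<open>v\<close> slightly
  keeps its saturated coordinates (finitely many, by square summability) saturated, so (b) implies
  (c). Finally, if \<open>u\<close> and \<open>v\<close> have the same saturated coefficients, then \<open>u - v\<close> is
  orthogonal to every \<open>x\<^sub>j\<close> that is unsaturated at the midpoint of \<open>u\<close> and \<open>v\<close>.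
\<close>

section \<open>Orthogonal projection in a finitely spanned inner product space\<close>

lemma orthogonal_projection_residual:
  fixes C :: "'a::real_inner set"
  assumes C: "finite C" "pairwise orthogonal C" and y: "y \<in> span C"
  shows "orthogonal (a - (\<Sum>b\<in>C. (b \<bullet> a / (b \<bullet> b)) *\<^sub>R b)) y"
proof (rule orthogonal_to_span[OF y])
  fix c assume c: "c \<in> C"
  \<comment> \<open>The case \<open>c = 0\<close> is harmless: division by zero gives coefficient 0,
    and \<open>c \<bullet> a\<close> is 0 too. So \<open>C\<close> may contain the zero
    vector.\<close>
  have "(\<Sum>b\<in>C. (b \<bullet> a / (b \<bullet> b)) * (b \<bullet> c)) = (\<Sum>b\<in>C. if b = c then c \<bullet> a else 0)"
    using C(2) c by (intro sum.cong refl) (auto simp: pairwise_def orthogonal_def)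
  also have "\<dots> = c \<bullet> a"
    using C(1) c by simp
  finally show "orthogonal (a - (\<Sum>b\<in>C. (b \<bullet> a / (b \<bullet> b)) *\<^sub>R b)) c"
    by (simp add: orthogonal_def inner_diff_left inner_sum_left inner_commute[of a c])
qed

text \<open>A maximal independent subset of \<open>F\<close> is no larger than \<open>S\<close>,
  hence finite, and can be orthogonalised. Any vector outside its span then leaves a nonzero
  residual after projection.\<close>

lemma orthogonal_complement_nonzero:
  fixes F :: "'a::real_inner set"
  assumes S: "finite S" "span S = (UNIV :: 'a set)" and F: "span F \<noteq> UNIV"
  obtains w where "w \<noteq> 0" "\<And>f. f \<in> F \<Longrightarrow> w \<bullet> f = 0"
proof -
  obtain B where B: "B \<subseteq> F" "independent B" "F \<subseteq> span B"
    using maximal_independent_subset by blast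
  have "finite B"
    using independent_span_bound[OF S(1) B(2)] S(2) by simp
  then obtain C where C: "finite C" "span C = span B" "pairwise orthogonal C"
    using basis_orthogonal by metis
  have "span B = span F"
    using B by (metis span_mono span_minimal subspace_span subset_antisym)
  then obtain z where z: "z \<notin> span C"
    using C(2) F by auto
  define w where "w = z - (\<Sum>b\<in>C. (b \<bullet> z / (b \<bullet> b)) *\<^sub>R b)"
  show thesis
  proof
    have "(\<Sum>b\<in>C. (b \<bullet> z / (b \<bullet> b)) *\<^sub>R b) \<in> span C"
      by (intro span_sum span_scale span_base)
    then show "w \<noteq> 0"
      using z by (auto simp: w_def)
    show "w \<bullet> f = 0" if "f \<in> F" for f
    proof -
      have "f \<in> span C"
        using that B(3) C(2) by auto
      then have "orthogonal w f"
        unfolding w_def by (rule orthogonal_projection_residual[OF C(1,3)])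
      then show ?thesis
        by (simp add: orthogonal_def)
    qed
  qed
qed

text \<open>Triangle inequality for the expansion of \<open>u\<close> in an orthogonal spanning set.
  It reduces a lower frame bound to bounding finitely many functionals.\<close>

lemma norm_le_sum_inner:
  fixes S :: "'a::real_inner set"
  assumes "finite S" "span S = UNIV"
  obtains C :: "'a set" where "finite C" "\<And>u. norm u \<le> (\<Sum>b\<in>C. \<bar>u \<bullet> b\<bar> / norm b)"
proof -
  obtain C where C: "finite C" "span C = span S" "pairwise orthogonal C"
    using basis_orthogonal[OF assms(1)] by metis
  show thesis
  proof
    show "norm u \<le> (\<Sum>b\<in>C. \<bar>u \<bullet> b\<bar> / norm b)" for u
    proof -
      let ?p = "\<Sum>b\<in>C. (b \<bullet> u / (b \<bullet> b)) *\<^sub>R b"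
      \<comment> \<open>Since \<open>C\<close> spans everything, the residual lies in its span, so
        it is orthogonal to itself and vanishes.\<close>
      have "orthogonal (u - ?p) (u - ?p)"
        using C(2) assms(2) by (intro orthogonal_projection_residual[OF C(1,3)]) simp
      then have "norm u = norm ?p"
        by (simp add: orthogonal_def)
      also have "\<dots> \<le> (\<Sum>b\<in>C. norm ((b \<bullet> u / (b \<bullet> b)) *\<^sub>R b))"
        by (rule norm_sum)
      also have "\<dots> = (\<Sum>b\<in>C. \<bar>u \<bullet> b\<bar> / norm b)"
        by (intro sum.cong refl)
          (auto simp: inner_commute dot_square_norm power2_eq_square)
      finally show ?thesis .
    qed
  qed (use C in auto)
qed

section \<open>Frame bounds and subfamilies of frames\<close>

lemma frame_on_summable:
  "frame_on J x \<Longrightarrow> (\<lambda>j. \<bar>v \<bullet> x j\<bar>\<^sup>2) summable_on J"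
  unfolding frame_on_def by blast

lemma inner_sq_le_infsum:
  assumes "(\<lambda>j. \<bar>v \<bullet> x j\<bar>\<^sup>2) summable_on K" "k \<in> K"
  shows "\<bar>v \<bullet> x k\<bar>\<^sup>2 \<le> (\<Sum>\<^sub>\<infinity>j\<in>K. \<bar>v \<bullet> x j\<bar>\<^sup>2)"
  using finite_sum_le_infsum[OF assms(1), of "{k}"] assms(2) by simp

lemma frame_on_orthogonal_eq_0:
  assumes "frame_on K x" "\<And>j. j \<in> K \<Longrightarrow> v \<bullet> x j = 0"
  shows "v = 0"
proof -
  obtain A where A: "A > 0" "A * (norm v)\<^sup>2 \<le> (\<Sum>\<^sub>\<infinity>j\<in>K. \<bar>v \<bullet> x j\<bar>\<^sup>2)"
    using assms(1) unfolding frame_on_def by blast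
  moreover have "(\<Sum>\<^sub>\<infinity>j\<in>K. \<bar>v \<bullet> x j\<bar>\<^sup>2) = 0"
    using assms(2) by (intro infsum_0) auto
  ultimately have "(norm v)\<^sup>2 \<le> 0"
    by (simp add: mult_le_0_iff)
  then show ?thesis by simp
qed

text \<open>A single term is at most the whole sum, so \<open>sqrt B\<close> works. Uniformity in
  \<open>j\<close> lets one small perturbation serve all saturated indices, even infinitely many
  candidates \<open>j\<close>.\<close>

lemma frame_on_inner_bounded:
  assumes "frame_on J x"
  obtains b where "b > 0" "\<And>j v. j \<in> J \<Longrightarrow> \<bar>v \<bullet> x j\<bar> \<le> b * norm v"
proof -
  obtain B where B: "B > 0" "\<And>v. (\<Sum>\<^sub>\<infinity>j\<in>J. \<bar>v \<bullet> x j\<bar>\<^sup>2) \<le> B * (norm v)\<^sup>2"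
    using assms unfolding frame_on_def by blast
  show thesis
  proof
    show "\<bar>v \<bullet> x j\<bar> \<le> sqrt B * norm v" if "j \<in> J" for j v
    proof (rule power2_le_imp_le)
      show "\<bar>v \<bullet> x j\<bar>\<^sup>2 \<le> (sqrt B * norm v)\<^sup>2"
        using inner_sq_le_infsum[OF frame_on_summable[OF assms] that] B(2)[of v] B(1)
        by (fastforce simp: power_mult_distrib intro: order_trans)
    qed (use B in simp)
  qed (use B in simp)
qed

text \<open>Each such index contributes more than \<open>l\<^sup>2\<close> to a convergent
  sum.\<close>

lemma finite_saturated:
  assumes "frame_on J x" "l > 0"
  shows "finite {j \<in> J. \<not> \<bar>v \<bullet> x j\<bar> \<le> l}" (is "finite ?F")
proof (rule ccontr)
  assume inf: "infinite ?F"
  have sm: "(\<lambda>j. \<bar>v \<bullet> x j\<bar>\<^sup>2) summable_on J"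
    by (rule frame_on_summable[OF assms(1)])
  have "(\<lambda>j. l\<^sup>2) summable_on ?F"
  proof (rule summable_on_comparison_test)
    show "(\<lambda>j. \<bar>v \<bullet> x j\<bar>\<^sup>2) summable_on ?F"
      by (rule summable_on_subset_banach[OF sm]) auto
    show "l\<^sup>2 \<le> \<bar>v \<bullet> x j\<bar>\<^sup>2" if "j \<in> ?F" for j
      using that assms(2) by (intro power_mono) auto
  qed simp
  then show False
    using infsum_diverge_constant[OF inf, of "l\<^sup>2"] assms(2) by simp
qed

text \<open>The upper bound is inherited from \<open>J\<close>. The lower bound comes without
  compactness: the functionals dominated by the seminorm \<open>sqrt (N u)\<close> form a subspace
  containing the spanning family, so all are dominated, and finitely many of them control the
  norm.\<close>

lemma frame_on_subset:
  fixes x :: "'j \<Rightarrow> 'a::real_inner"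
  assumes S: "finite S" "span S = (UNIV :: 'a set)"
    and J: "frame_on J x" and K: "K \<subseteq> J"
    and orth: "\<And>v. (\<And>j. j \<in> K \<Longrightarrow> v \<bullet> x j = 0) \<Longrightarrow> v = 0"
  shows "frame_on K x"
proof -
  define N where "N v = (\<Sum>\<^sub>\<infinity>j\<in>K. \<bar>v \<bullet> x j\<bar>\<^sup>2)" for v
  have sK: "(\<lambda>j. \<bar>v \<bullet> x j\<bar>\<^sup>2) summable_on K" for v
    by (rule summable_on_subset_banach[OF frame_on_summable[OF J] K])
  have N0: "N v \<ge> 0" for v
    unfolding N_def by (rule infsum_nonneg) simp
  have span: "span (x ` K) = UNIV"
  proof (rule ccontr)
    assume "span (x ` K) \<noteq> UNIV"
    then obtain w where "w \<noteq> 0" "\<And>f. f \<in> x ` K \<Longrightarrow> w \<bullet> f = 0"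
      using orthogonal_complement_nonzero[OF S] by metis
    then show False using orth by blast
  qed
  \<comment> \<open>\<open>P\<close> collects the vectors \<open>v\<close> whose functional
    \<open>u \<bullet> v\<close> is at most a constant times the seminorm
    \<open>sqrt (N u)\<close>.\<close>
  define P where "P = {v. \<exists>c\<ge>0. \<forall>u. \<bar>u \<bullet> v\<bar> \<le> c * sqrt (N u)}"
  have "subspace P"
    unfolding subspace_def
  proof (intro conjI ballI allI)
    show "0 \<in> P" by (auto simp: P_def N0 intro: exI[of _ 0])
  next
    fix v w assume "v \<in> P" "w \<in> P"
    then obtain c d where c: "c \<ge> 0" "\<And>u. \<bar>u \<bullet> v\<bar> \<le> c * sqrt (N u)"
      and d: "d \<ge> 0" "\<And>u. \<bar>u \<bullet> w\<bar> \<le> d * sqrt (N u)"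
      unfolding P_def by blast
    have "\<bar>u \<bullet> (v + w)\<bar> \<le> (c + d) * sqrt (N u)" for u
      using c(2)[of u] d(2)[of u] by (simp add: inner_add_right distrib_right)
    then show "v + w \<in> P"
      unfolding P_def using c(1) d(1) by (auto intro!: exI[of _ "c + d"])
  next
    fix r :: real and v assume "v \<in> P"
    then obtain c where c: "c \<ge> 0" "\<And>u. \<bar>u \<bullet> v\<bar> \<le> c * sqrt (N u)"
      unfolding P_def by blast
    have "\<bar>u \<bullet> (r *\<^sub>R v)\<bar> \<le> (\<bar>r\<bar> * c) * sqrt (N u)" for u
      using mult_left_mono[OF c(2)[of u], of "\<bar>r\<bar>"] by (simp add: abs_mult mult.assoc)
    then show "r *\<^sub>R v \<in> P"
      unfolding P_def using c(1) by (auto intro!: exI[of _ "\<bar>r\<bar> * c"])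
  qed
  moreover have "x ` K \<subseteq> P"
  proof -
    have "\<bar>u \<bullet> x j\<bar> \<le> 1 * sqrt (N u)" if "j \<in> K" for u j
      using inner_sq_le_infsum[OF sK that, of u] by (simp add: N_def real_le_rsqrt)
    then show ?thesis
      unfolding P_def by (force intro: exI[of _ 1])
  qed
  ultimately have "P = UNIV"
    using span_minimal[of "x ` K" P] span by auto
  then have "\<forall>v. \<exists>c\<ge>0. \<forall>u. \<bar>u \<bullet> v\<bar> \<le> c * sqrt (N u)"
    unfolding P_def by blast
  then obtain c where c: "\<And>v. c v \<ge> 0" "\<And>v u. \<bar>u \<bullet> v\<bar> \<le> c v * sqrt (N u)"
    by metis
  obtain C :: "'a set" where C: "\<And>u. norm u \<le> (\<Sum>b\<in>C. \<bar>u \<bullet> b\<bar> / norm b)"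
    using norm_le_sum_inner[OF S] by metis
  \<comment> \<open>The summand 1 keeps \<open>D\<close> positive when the sum vanishes, as in the
    zero space.\<close>
  define D where "D = (\<Sum>b\<in>C. c b / norm b) + 1"
  have D: "D > 0"
    unfolding D_def by (intro add_nonneg_pos sum_nonneg) (auto simp: c)
  have low: "1 / D\<^sup>2 * (norm u)\<^sup>2 \<le> N u" for u
  proof -
    have "norm u \<le> (\<Sum>b\<in>C. \<bar>u \<bullet> b\<bar> / norm b)"
      by (rule C)
    also have "\<dots> \<le> (\<Sum>b\<in>C. c b * sqrt (N u) / norm b)"
      by (intro sum_mono divide_right_mono c) simp
    also have "\<dots> \<le> D * sqrt (N u)"
      by (simp add: D_def distrib_right sum_distrib_right N0)
    finally have "(norm u)\<^sup>2 \<le> (D * sqrt (N u))\<^sup>2"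
      by (intro power_mono) auto
    then show ?thesis
      using D by (simp add: power_mult_distrib N0 field_simps)
  qed
  obtain B where B: "B > 0" "\<And>v. (\<Sum>\<^sub>\<infinity>j\<in>J. \<bar>v \<bullet> x j\<bar>\<^sup>2) \<le> B * (norm v)\<^sup>2"
    using J unfolding frame_on_def by blast
  have "N v \<le> B * (norm v)\<^sup>2" for v
  proof -
    have "N v \<le> (\<Sum>\<^sub>\<infinity>j\<in>J. \<bar>v \<bullet> x j\<bar>\<^sup>2)"
      unfolding N_def
      by (rule infsum_mono_neutral[OF sK frame_on_summable[OF J]]) (use K in auto)
    then show ?thesis using B(2) order_trans by blast
  qed
  then show ?thesis
    unfolding frame_on_def using low sK D B(1) unfolding N_def
    by (intro exI[of _ "1 / D\<^sup>2"] exI[of _ B] conjI) auto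
qed

section \<open>When saturation identifies two real numbers\<close>

lemma sat_eq_above:
  assumes "l > 0" "\<bar>s\<bar> \<ge> l + d" "\<bar>t - s\<bar> \<le> d"
  shows "sat l t = sat l s"
  \<comment> \<open>As \<open>d < \<bar>s\<bar>\<close>, the numbers \<open>s\<close> and
    \<open>t\<close> have the same sign, and both have modulus at least \<open>l\<close>.\<close>
  using assms by (cases "s > 0") (auto simp: sat_def sgn_if)

text \<open>If distinct numbers saturate equally, both lie at or beyond the same threshold and one
  lies strictly beyond, which puts the midpoint strictly beyond as well.\<close>

lemma sat_eq_midpoint_unsat:
  assumes "l > 0" "sat l s = sat l t" "\<bar>(s + t) / 2\<bar> \<le> l"
  shows "s = t"
  using assms by (auto simp: sat_def sgn_if split: if_splits)

lemma saturation_recovery_iff: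
  "saturation_recovery l J x X \<longleftrightarrow>
    (\<forall>u\<in>X. \<forall>v\<in>X. (\<forall>j\<in>J. sat l (u \<bullet> x j) = sat l (v \<bullet> x j)) \<longrightarrow> u = v)"
proof -
  have "(sat_op l J \<circ> analysis_op J x) u = (sat_op l J \<circ> analysis_op J x) v \<longleftrightarrow>
      (\<forall>j\<in>J. sat l (u \<bullet> x j) = sat l (v \<bullet> x j))" for u v
    by (auto simp: sat_op_def analysis_op_def restrict_def fun_eq_iff)
  then show ?thesis
    by (simp add: saturation_recovery_def inj_on_def)
qed

section \<open>The cycle of implications\<close>

lemma frame_on_strict_unsat_index:
  fixes x :: "'j \<Rightarrow> 'a::real_inner"
  assumes S: "finite S" "span S = (UNIV :: 'a set)"
    and J: "frame_on J x" and l: "l > 0"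
    and rec: "saturation_recovery l J x (cball 0 \<alpha>)" and v: "norm v < \<alpha>"
  shows "frame_on (strict_unsat_index l J x v) x"
proof (rule frame_on_subset[OF S J])
  fix w assume w: "\<And>j. j \<in> strict_unsat_index l J x v \<Longrightarrow> w \<bullet> x j = 0"
  obtain b where b: "b > 0" "\<And>j v. j \<in> J \<Longrightarrow> \<bar>v \<bullet> x j\<bar> \<le> b * norm v"
    using frame_on_inner_bounded[OF J] by blast
  define n where "n = norm v"
  \<comment> \<open>The stretch uses at most half of the distance \<open>\<alpha> - n\<close> to the
    sphere; \<open>n + 1\<close> avoids dividing by zero when \<open>v = 0\<close>.\<close>
  define e where "e = (\<alpha> - n) / (2 * (n + 1))"
  have n: "n \<ge> 0" "n < \<alpha>" using v by (auto simp: n_def)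
  have e: "e > 0" using n by (simp add: e_def)
  have en: "e * n \<le> (\<alpha> - n) / 2"
    using n by (simp add: e_def field_simps)
  \<comment> \<open>The first bound keeps \<open>t *\<^sub>R w\<close> within the other half of that
    distance. The second keeps each coefficient change, at most \<open>b * (t * norm w)\<close>,
    within the margin \<open>e * l\<close> gained by stretching.\<close>
  define t where "t = min ((\<alpha> - n) / 2) (e * l / b) / (norm w + 1)"
  have t0: "t > 0"
    using n e l b(1) by (simp add: t_def add_nonneg_pos)
  have tw: "t * norm w \<le> min ((\<alpha> - n) / 2) (e * l / b)"
  proof -
    have "t * norm w \<le> t * (norm w + 1)" using t0 by simp
    also have "\<dots> = min ((\<alpha> - n) / 2) (e * l / b)"
      unfolding t_def using norm_ge_zero[of w] by (simp add: add_nonneg_eq_0_iff)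
    finally show ?thesis .
  qed
  define v' where "v' = (1 + e) *\<^sub>R v"
  have nv': "norm v' = n + e * n"
    using e by (simp add: v'_def n_def distrib_right)
  have "v' \<in> cball 0 \<alpha>"
    using en n nv' by simp
  moreover have "v' + t *\<^sub>R w \<in> cball 0 \<alpha>"
  proof -
    have "norm (v' + t *\<^sub>R w) \<le> norm v' + t * norm w"
      using norm_triangle_ineq[of v' "t *\<^sub>R w"] t0 by simp
    also have "\<dots> \<le> \<alpha>"
      using nv' en tw by simp
    finally show ?thesis by simp
  qed
  moreover have "sat l ((v' + t *\<^sub>R w) \<bullet> x j) = sat l (v' \<bullet> x j)" if "j \<in> J" for j
  proof (cases "\<bar>v \<bullet> x j\<bar> < l")
    case True
    then have "w \<bullet> x j = 0"
      using that by (intro w) (simp add: strict_unsat_index_def)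
    then show ?thesis by (simp add: inner_add_left)
  next
    case False
    have "(1 + e) * l \<le> (1 + e) * \<bar>v \<bullet> x j\<bar>"
      using False e by (intro mult_left_mono) auto
    then have "\<bar>v' \<bullet> x j\<bar> \<ge> l + e * l"
      using e by (simp add: v'_def abs_mult distrib_right)
    moreover have "\<bar>t * (w \<bullet> x j)\<bar> \<le> e * l"
    proof -
      have "\<bar>t * (w \<bullet> x j)\<bar> \<le> t * (b * norm w)"
        using b(2)[OF that, of w] t0 by (simp add: abs_mult)
      also have "\<dots> = b * (t * norm w)" by simp
      also have "\<dots> \<le> b * (e * l / b)"
        using tw b(1) by (intro mult_left_mono) auto
      finally show ?thesis using b(1) by simp
    qed
    ultimately show ?thesis
      using l by (intro sat_eq_above[where d = "e * l"]) (auto simp: inner_add_left)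
  qed
  ultimately have "v' + t *\<^sub>R w = v'"
    using rec unfolding saturation_recovery_iff by blast
  then show "w = 0" using t0 by simp
qed (auto simp: strict_unsat_index_def)

lemma frame_on_unsat_index:
  fixes x :: "'j \<Rightarrow> 'a::real_inner"
  assumes S: "finite S" "span S = (UNIV :: 'a set)"
    and J: "frame_on J x" and l: "l > 0" and \<alpha>: "\<alpha> > 0"
    and strict: "\<And>v. norm v < \<alpha> \<Longrightarrow> frame_on (strict_unsat_index l J x v) x"
    and v: "norm v \<le> \<alpha>"
  shows "frame_on (unsat_index l J x v) x"
proof (rule frame_on_subset[OF S J])
  fix w assume w: "\<And>j. j \<in> unsat_index l J x v \<Longrightarrow> w \<bullet> x j = 0"
  let ?F = "{j \<in> J. \<not> \<bar>v \<bullet> x j\<bar> \<le> l}"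
  \<comment> \<open>The least factor, from 1/2 up, that keeps every coefficient in \<open>?F\<close>
    at modulus at least \<open>l\<close>. It is below 1 because \<open>?F\<close> is finite; the
    entry 1/2 makes the set nonempty and \<open>r\<close> positive.\<close>
  define r where "r = Max (insert (1/2) ((\<lambda>j. l / \<bar>v \<bullet> x j\<bar>) ` ?F))"
  have fin: "finite (insert (1/2) ((\<lambda>j. l / \<bar>v \<bullet> x j\<bar>) ` ?F))"
    using finite_saturated[OF J l] by simp
  have r1: "r < 1"
    unfolding r_def using fin l by (subst Max_less_iff) auto
  have r0: "r \<ge> 1/2"
    unfolding r_def using fin by (intro Max_ge) auto
  have rF: "r * \<bar>v \<bullet> x j\<bar> \<ge> l" if "j \<in> ?F" for j
  proof -
    have "l / \<bar>v \<bullet> x j\<bar> \<le> r"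
      unfolding r_def using fin that by (intro Max_ge) auto
    moreover have "\<bar>v \<bullet> x j\<bar> > 0" using that l by auto
    ultimately show ?thesis by (simp only: pos_divide_le_eq)
  qed
  have "norm (r *\<^sub>R v) < \<alpha>"
  proof -
    have "r * norm v \<le> r * \<alpha>" using v r0 by (intro mult_left_mono) auto
    also have "\<dots> < \<alpha>" using r1 \<alpha> by simp
    finally show ?thesis using r0 by simp
  qed
  then have "frame_on (strict_unsat_index l J x (r *\<^sub>R v)) x"
    by (rule strict)
  moreover have "strict_unsat_index l J x (r *\<^sub>R v) \<subseteq> unsat_index l J x v"
  proof
    fix j assume j: "j \<in> strict_unsat_index l J x (r *\<^sub>R v)"
    then have "j \<in> J" "r * \<bar>v \<bullet> x j\<bar> < l"
      using r0 by (auto simp: strict_unsat_index_def abs_mult)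
    then show "j \<in> unsat_index l J x v"
      using rF[of j] by (force simp: unsat_index_def)
  qed
  ultimately show "w = 0"
    using w by (blast intro: frame_on_orthogonal_eq_0)
qed (auto simp: unsat_index_def)

lemma saturation_recovery_cball:
  assumes l: "l > 0"
    and frame: "\<And>v. norm v \<le> \<alpha> \<Longrightarrow> frame_on (unsat_index l J x v) x"
  shows "saturation_recovery l J x (cball 0 \<alpha>)"
  unfolding saturation_recovery_iff
proof (intro ballI impI)
  fix u v
  assume u: "u \<in> cball 0 \<alpha>" and v: "v \<in> cball 0 \<alpha>"
    and eq: "\<forall>j\<in>J. sat l (u \<bullet> x j) = sat l (v \<bullet> x j)"
  \<comment> \<open>By convexity the midpoint stays in the ball, so its unsaturated family is a
    frame and can detect \<open>u - v\<close>.\<close>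
  define m where "m = (1/2) *\<^sub>R (u + v)"
  have "norm m \<le> \<alpha>"
    using norm_triangle_ineq[of u v] u v by (simp add: m_def)
  moreover have "(u - v) \<bullet> x j = 0" if "j \<in> unsat_index l J x m" for j
  proof -
    have "\<bar>(u \<bullet> x j + v \<bullet> x j) / 2\<bar> \<le> l" "j \<in> J"
      using that by (auto simp: unsat_index_def m_def inner_add_left)
    then show ?thesis
      using sat_eq_midpoint_unsat[OF l] eq by (simp add: inner_diff_left)
  qed
  ultimately have "u - v = 0"
    using frame frame_on_orthogonal_eq_0 by blast
  then show "u = v" by simp
qed

theorem theorem2p1:
  fixes x :: "'j \<Rightarrow> 'a::real_inner" and J :: "'j set" and l \<alpha> :: real
  assumes "\<exists>S::'a set. finite S \<and> span S = UNIV"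
    and "frame_on J x" and "l > 0" and "\<alpha> > 0"
  shows "(saturation_recovery l J x ((\<lambda>v. \<alpha> *\<^sub>R v) ` cball 0 1) \<longleftrightarrow>
           (\<forall>v. norm v < \<alpha> \<longrightarrow> frame_on (strict_unsat_index l J x v) x)) \<and>
         ((\<forall>v. norm v < \<alpha> \<longrightarrow> frame_on (strict_unsat_index l J x v) x) \<longleftrightarrow>
           (\<forall>v. norm v \<le> \<alpha> \<longrightarrow> frame_on (unsat_index l J x v) x))"
proof -
  obtain S :: "'a set" where S: "finite S" "span S = UNIV"
    using assms(1) by blast
  have ball: "(\<lambda>v::'a. \<alpha> *\<^sub>R v) ` cball 0 1 = cball 0 \<alpha>"
    using assms(4) by (simp add: cball_scale)
  show ?thesis
    unfolding ball
    using frame_on_strict_unsat_index[OF S assms(2,3)]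
      frame_on_unsat_index[OF S assms(2-4)] saturation_recovery_cball[OF assms(3)]
    by blast
qed

end
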